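(* Let $n\geq1$ and let $\mathcal P_n$ be the partition monoid of degree $n$. For any $a,b\in\mathcal P_n$ we have $$\operatorname{rank}(a)+\operatorname{rank}(b)\leq\operatorname{rank}(ab)+n.$$ Consequently, $\mathcal P_n$ has a ${}^*$-symmetric twisting given by $$\Phi(a,b)=n-\operatorname{rank}(a)-\operatorname{rank}(b)+\operatorname{rank}(ab).$$
   Context: Write $\mathbf n=\{1,\dots,n\}$, $\mathbf n'=\{1',\dots,n'\}$, $\mathbf n''=\{1'',\dots,n''\}$ (disjoint copies). $\mathcal P_n$ is the set of all set partitions of $\mathbf n\cup\mathbf n'$. A partition is identified with any graph on $\mathbf n\cup\mathbf n'$ whose connected components are its blocks. For $a,b\in\mathcal P_n$, let $a^\vee$ be $a$ with each $x'$ renamed $x''$ and $b^\wedge$ be $b$ with each $x$ renamed $x''$; the product graph $\Pi(a,b)$ on $\mathbf n\cup\mathbf n''\cup\mathbf n'$ has as edges the union of the edges of $a^\vee$ and $b^\wedge$. The product $ab\in\mathcal P_n$ is the partition in which $x,y\in\mathbf n\cup\mathbf n'$ are in the same block iff they are in the same connected component of $\Pi(a,b)$. A transversal of $a$ is a block meeting both $\mathbf n$ and $\mathbf n'$; $\operatorname{rank}(a)$ is the number of transversals of $a$. The involution $a\mapsto a^*$ of $\mathcal P_n$ interchanges $x\leftrightarrow x'$ for all $x\in\mathbf n$. A twisting of a monoid $S$ is a map $\Phi:S\times S\to\mathbb N=\{0,1,2,\dots\}$ with $\Phi(a,b)+\Phi(ab,c)=\Phi(a,bc)+\Phi(b,c)$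 for all $a,b,c\in S$. If $S$ has an involution ${}^*$, the twisting is ${}^*$-symmetric if $\Phi(a,b)=\Phi(b^*,a^* )$ for all $a,b\in S$. *)

theory Defs
  imports "HOL-Algebra.Group" "HOL-Library.Disjoint_Sets"
begin

text \<open>
  \<open>Plain x\<close>, \<open>Primed x\<close>, \<open>DPrimed x\<close> stand for $x$, $x'$, $x''$. Graphs are given by their
  edge relations, on which no symmetry is imposed; loops are harmless.
\<close>

datatype vertex = Plain nat | Primed nat | DPrimed nat

definition plain_verts :: "nat \<Rightarrow> vertex set"
  where "plain_verts n = Plain ` {1..n}"

definition primed_verts :: "nat \<Rightarrow> vertex set"
  where "primed_verts n = Primed ` {1..n}"

definition verts :: "nat \<Rightarrow> vertex set"
  where "verts n = plain_verts n \<union> primed_verts n"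

definition partitions :: "nat \<Rightarrow> vertex set set set"
  where "partitions n = {a. partition_on (verts n) a}"

definition connection :: "('v \<times> 'v) set \<Rightarrow> ('v \<times> 'v) set"
  where "connection E = (E \<union> E\<inverse>)\<^sup>*"

definition components :: "'v set \<Rightarrow> ('v \<times> 'v) set \<Rightarrow> 'v set set"
  where "components V E = V // (connection E \<inter> V \<times> V)"

definition represents :: "nat \<Rightarrow> (vertex \<times> vertex) set \<Rightarrow> vertex set set \<Rightarrow> bool"
  where "represents n E a \<longleftrightarrow> E \<subseteq> verts n \<times> verts n \<and> components (verts n) E = a"

text \<open>The canonical choice of a graph representing a partition: each block is made complete.\<close>

definition block_graph :: "'v set set \<Rightarrow> ('v \<times> 'v) set"
  where "block_graph a = (\<Union>A\<in>a. A \<times> A)"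

fun lower_to_middle :: "vertex \<Rightarrow> vertex" where
  "lower_to_middle (Plain x) = Plain x"
| "lower_to_middle (Primed x) = DPrimed x"
| "lower_to_middle (DPrimed x) = DPrimed x"

fun upper_to_middle :: "vertex \<Rightarrow> vertex" where
  "upper_to_middle (Plain x) = DPrimed x"
| "upper_to_middle (Primed x) = Primed x"
| "upper_to_middle (DPrimed x) = DPrimed x"

definition glue :: "(vertex \<times> vertex) set \<Rightarrow> (vertex \<times> vertex) set \<Rightarrow> (vertex \<times> vertex) set"
  where "glue E F =
    map_prod lower_to_middle lower_to_middle ` E \<union> map_prod upper_to_middle upper_to_middle ` F"

definition product_graph ::
    "vertex set set \<Rightarrow> vertex set set \<Rightarrow> (vertex \<times> vertex) set"
  where "product_graph a b = glue (block_graph a) (block_graph b)"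

text \<open>
  Connecting paths run through all of the product graph, middle vertices included; only their
  end points are restricted to \<open>verts n\<close>.
\<close>

definition partition_product :: "nat \<Rightarrow> vertex set set \<Rightarrow> vertex set set \<Rightarrow> vertex set set"
  where "partition_product n a b = components (verts n) (product_graph a b)"

definition identity_partition :: "nat \<Rightarrow> vertex set set"
  where "identity_partition n = (\<lambda>x. {Plain x, Primed x}) ` {1..n}"

definition partition_monoid :: "nat \<Rightarrow> vertex set set monoid"
  where "partition_monoid n =
    \<lparr>carrier = partitions n, monoid.mult = partition_product n, one = identity_partition n\<rparr>"

definition transversals :: "nat \<Rightarrow> vertex set set \<Rightarrow> vertex set set"
  where "transversals n a = {A \<in> a. A \<inter> plain_verts n \<noteq> {} \<and> A \<inter> primed_verts n \<noteq> {}}"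

definition rank :: "nat \<Rightarrow> vertex set set \<Rightarrow> nat"
  where "rank n a = card (transversals n a)"

fun swap_primes :: "vertex \<Rightarrow> vertex" where
  "swap_primes (Plain x) = Primed x"
| "swap_primes (Primed x) = Plain x"
| "swap_primes (DPrimed x) = DPrimed x"

definition star :: "vertex set set \<Rightarrow> vertex set set"
  where "star a = (`) swap_primes ` a"

definition twisting :: "('a, 'm) monoid_scheme \<Rightarrow> ('a \<Rightarrow> 'a \<Rightarrow> nat) \<Rightarrow> bool"
  where "twisting S \<Phi> \<longleftrightarrow> monoid S \<and>
    (\<forall>a\<in>carrier S. \<forall>b\<in>carrier S. \<forall>c\<in>carrier S.
      \<Phi> a b + \<Phi> (a \<otimes>\<^bsub>S\<^esub> b) c = \<Phi> a (b \<otimes>\<^bsub>S\<^esub> c) + \<Phi> b c)"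

definition involution :: "('a, 'm) monoid_scheme \<Rightarrow> ('a \<Rightarrow> 'a) \<Rightarrow> bool"
  where "involution S inv_op \<longleftrightarrow>
    (\<forall>a\<in>carrier S. inv_op a \<in> carrier S \<and> inv_op (inv_op a) = a) \<and>
    (\<forall>a\<in>carrier S. \<forall>b\<in>carrier S. inv_op (a \<otimes>\<^bsub>S\<^esub> b) = inv_op b \<otimes>\<^bsub>S\<^esub> inv_op a)"

definition symmetric_twisting ::
    "('a, 'm) monoid_scheme \<Rightarrow> ('a \<Rightarrow> 'a) \<Rightarrow> ('a \<Rightarrow> 'a \<Rightarrow> nat) \<Rightarrow> bool"
  where "symmetric_twisting S inv_op \<Phi> \<longleftrightarrow> twisting S \<Phi> \<and> involution S inv_op \<and>
    (\<forall>a\<in>carrier S. \<forall>b\<in>carrier S. \<Phi> a b = \<Phi> (inv_op b) (inv_op a))"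

text \<open>The product does not depend on the graphs chosen to represent the factors.\<close>

lemma represents_block_graph:
  assumes "a \<in> partitions n"
  shows "represents n (block_graph a) a"
proof -
  have p: "partition_on (verts n) a" using assms by (simp add: partitions_def)
  have eqv: "equiv (verts n) (block_graph a)"
  proof -
    have "block_graph a = {(x, y). \<exists>A\<in>a. x \<in> A \<and> y \<in> A}" by (auto simp: block_graph_def)
    then show ?thesis using equiv_partition_on[OF p] by simp
  qed
  have sub: "block_graph a \<subseteq> verts n \<times> verts n"
    using p by (auto simp: block_graph_def partition_on_def)
  have "connection (block_graph a) = (block_graph a)\<^sup>*"
    using eqv by (auto simp: connection_def equiv_def dest: sym_conv_converse_eq[THEN iffD1])
  moreover have "(block_graph a)\<^sup>* = block_graph a \<union> Id"
    using eqv by (simp add: equiv_def rtrancl_trancl_reflcl trancl_id)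
  moreover have "Id \<inter> verts n \<times> verts n \<subseteq> block_graph a"
    using eqv by (auto simp: equiv_def refl_on_def)
  ultimately have "connection (block_graph a) \<inter> verts n \<times> verts n = block_graph a"
    using sub by auto
  moreover have "block_graph a = {(x, y). \<exists>A\<in>a. x \<in> A \<and> y \<in> A}" by (auto simp: block_graph_def)
  ultimately show ?thesis
    using partition_on_eq_quotient[OF p] sub by (simp add: represents_def components_def)
qed

lemma connection_glue_mono:
  assumes "E \<subseteq> connection E'" "F \<subseteq> connection F'"
  shows "connection (glue E F) \<subseteq> connection (glue E' F')"
proof -
  let ?C = "connection (glue E' F')"
  have lift: "(f x, f y) \<in> ?C"
    if "(x, y) \<in> connection G" "map_prod f f ` G \<subseteq> glue E' F'" for f x y G
    using that(1) unfolding connection_def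
  proof (induction rule: rtrancl_induct)
    case (step y z)
    have "(f y, f z) \<in> glue E' F' \<union> (glue E' F')\<inverse>" using step(2) that(2) by force
    with step(3) show ?case by (rule rtrancl_into_rtrancl)
  qed simp
  have "glue E F \<subseteq> ?C"
    using assms lift[of _ _ E' lower_to_middle] lift[of _ _ F' upper_to_middle]
    unfolding glue_def by fastforce
  moreover have "sym ?C"
    unfolding connection_def by (intro sym_rtrancl) (auto simp: sym_def)
  ultimately have "glue E F \<union> (glue E F)\<inverse> \<subseteq> ?C"
    by (auto dest: symD)
  then show ?thesis
    unfolding connection_def by (rule rtrancl_subset_rtrancl)
qed

lemma block_graph_components:
  assumes "represents n E a"
  shows "block_graph a = connection E \<inter> verts n \<times> verts n"
proof -
  have "sym (connection E)"
    unfolding connection_def by (intro sym_rtrancl) (auto simp: sym_def)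
  then have "equiv (verts n) (connection E \<inter> verts n \<times> verts n)"
    unfolding equiv_def refl_on_def connection_def sym_def trans_def
    by (auto intro: rtrancl_trans)
  then have "(\<Union>A\<in>verts n // (connection E \<inter> verts n \<times> verts n). A \<times> A)
      = connection E \<inter> verts n \<times> verts n"
    by (auto simp: quotient_def equiv_def dest: symD transD)
  then show ?thesis
    using assms by (auto simp: represents_def components_def block_graph_def)
qed

lemma partition_product_representatives:
  assumes "represents n E a" "represents n F b"
  shows "partition_product n a b = components (verts n) (glue E F)"
proof -
  have sub: "G \<subseteq> connection G" for G :: "(vertex \<times> vertex) set"
    by (auto simp: connection_def)
  have "block_graph a \<subseteq> connection E" "block_graph b \<subseteq> connection F"
    using assms[THEN block_graph_components] by auto
  moreover have "E \<subseteq> block_graph a" "F \<subseteq> block_graph b"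
    using assms[THEN block_graph_components] assms sub unfolding represents_def by blast+
  then have "E \<subseteq> connection (block_graph a)" "F \<subseteq> connection (block_graph b)"
    using sub by blast+
  ultimately have "connection (product_graph a b) = connection (glue E F)"
    unfolding product_graph_def by (intro equalityI connection_glue_mono)
  then show ?thesis by (simp add: partition_product_def components_def)
qed

end

theory Submission
  imports Defs
begin

text \<open>
  Join the blocks of \<open>a\<close> to the blocks of \<open>b\<close> by one edge for each \<open>i\<close>, from the block of \<open>a\<close>
  containing $i'$ to the block of \<open>b\<close> containing $i$. Having $n$ edges, this graph has at least
  $|a| + |b| - n$ components. A component all of whose blocks are transversals gives rise to
  a transversal of \<open>ab\<close>, and distinct ones give distinct transversals; every other component
  contains one of the $(|a| - \mathrm{rank}(a)) + (|b| - \mathrm{rank}(b))$ blocks that are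
  not transversals. Comparing the two counts gives the inequality. The twisting identity is then
  associativity, and symmetry holds because the involution preserves the rank.
\<close>

section \<open>Connectivity\<close>

lemma sym_connection: "sym (connection E)"
  unfolding connection_def by (intro sym_rtrancl) (auto simp: sym_def)

lemma connection_refl [simp]: "(x, x) \<in> connection E"
  by (simp add: connection_def)

lemma connection_sym: "(x, y) \<in> connection E \<Longrightarrow> (y, x) \<in> connection E"
  using sym_connection by (metis symD)

lemma connection_trans:
  "(x, y) \<in> connection E \<Longrightarrow> (y, z) \<in> connection E \<Longrightarrow> (x, z) \<in> connection E"
  unfolding connection_def by (rule rtrancl_trans)

lemma connection_edge: "(x, y) \<in> E \<Longrightarrow> (x, y) \<in> connection E"
  by (auto simp: connection_def)

text \<open>Edges may go to connected pairs rather than to edges. One lemma thus serves monotonicity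
  (with the identity map), left inverses, foldings of a graph and the passage from vertices to
  blocks.\<close>

lemma connection_map:
  assumes "(x, y) \<in> connection E" and "\<And>u v. (u, v) \<in> E \<Longrightarrow> (f u, f v) \<in> connection F"
  shows "(f x, f y) \<in> connection F"
  using assms(1) unfolding connection_def[of E]
proof (induction rule: rtrancl_induct)
  case (step y z)
  from step.hyps(2) have "(f y, f z) \<in> connection F"
    by (elim UnE converseE) (simp_all add: assms(2) connection_sym)
  with step.IH show ?case by (rule connection_trans)
qed simp

lemma connection_least: "E \<subseteq> connection F \<Longrightarrow> connection E \<subseteq> connection F"
  by (rule subrelI) (rule connection_map[of _ _ E "\<lambda>x. x" F], auto)

text \<open>Paths in the image graph are pulled back along the left inverse of
  \<open>f\<close>.\<close>

lemma connection_map_inj: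
  assumes "inj f"
  shows "(f x, f y) \<in> connection (map_prod f f ` E) \<longleftrightarrow> (x, y) \<in> connection E"
proof
  assume "(f x, f y) \<in> connection (map_prod f f ` E)"
  then have "(inv_into UNIV f (f x), inv_into UNIV f (f y)) \<in> connection E"
    by (rule connection_map) (auto simp: assms intro: connection_edge)
  then show "(x, y) \<in> connection E" by (simp add: assms)
next
  assume "(x, y) \<in> connection E"
  then show "(f x, f y) \<in> connection (map_prod f f ` E)"
    by (rule connection_map) (auto intro: connection_edge)
qed

section \<open>Components as equivalence classes\<close>

lemma equiv_connection: "equiv V (connection E \<inter> V \<times> V)"
proof (rule equivI)
  show "sym (connection E \<inter> V \<times> V)"
    using sym_connection[of E] by (auto simp: sym_def)
  show "trans (connection E \<inter> V \<times> V)"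
    by (rule transI) (blast intro: connection_trans)
qed (auto simp: refl_on_def)

lemma partition_on_components: "partition_on V (components V E)"
  unfolding components_def by (rule partition_on_quotient[OF equiv_connection])

lemma block_graph_quotient:
  assumes "equiv V r"
  shows "block_graph (V // r) = r"
proof (intro equalityI subrelI)
  fix x y assume "(x, y) \<in> block_graph (V // r)"
  then obtain A where "A \<in> V // r" "x \<in> A" "y \<in> A" by (auto simp: block_graph_def)
  then show "(x, y) \<in> r" using quotient_eq_iff[OF assms] by blast
next
  fix x y assume xy: "(x, y) \<in> r"
  then have "x \<in> V" using assms by (auto simp: equiv_def)
  then have "r `` {x} \<in> V // r" "x \<in> r `` {x}"
    using equiv_class_self[OF assms] by (simp_all add: quotientI)
  with xy show "(x, y) \<in> block_graph (V // r)" by (auto simp: block_graph_def)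
qed

lemma block_graph_components_eq: "block_graph (components V E) = connection E \<inter> V \<times> V"
  unfolding components_def by (rule block_graph_quotient[OF equiv_connection])

lemma components_cong:
  assumes "\<And>x y. x \<in> V \<Longrightarrow> y \<in> V \<Longrightarrow> (x, y) \<in> connection E \<longleftrightarrow> (x, y) \<in> connection F"
  shows "components V E = components V F"
proof -
  have "connection E \<inter> V \<times> V = connection F \<inter> V \<times> V"
    using assms by auto
  then show ?thesis by (simp add: components_def)
qed

lemma components_image:
  assumes "inj f"
  shows "components (f ` V) (map_prod f f ` E) = (`) f ` components V E"
proof -
  have "(connection (map_prod f f ` E) \<inter> f ` V \<times> f ` V) `` {f x}
      = f ` ((connection E \<inter> V \<times> V) `` {x})" for x
    by (auto simp: connection_map_inj[OF assms] inj_eq[OF assms] image_iff)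
  then show ?thesis
    by (auto simp: components_def quotient_def image_image)
qed

text \<open>A path in \<open>G \<union> H\<close> leaves \<open>G\<close> only through \<open>W\<close>, so its maximal stretches in \<open>G\<close> can be
  contracted.\<close>

lemma connection_contract:
  assumes W: "Field G \<inter> Field H \<subseteq> W"
    and x: "x \<in> Field G \<Longrightarrow> x \<in> W" and y: "y \<in> Field G \<Longrightarrow> y \<in> W"
  shows "(x, y) \<in> connection (connection G \<inter> W \<times> W \<union> H) \<longleftrightarrow> (x, y) \<in> connection (G \<union> H)"
    (is "_ \<in> connection ?R \<longleftrightarrow> _")
proof
  have "connection G \<subseteq> connection (G \<union> H)"
    by (rule connection_least) (auto intro: connection_edge)
  then have "connection ?R \<subseteq> connection (G \<union> H)"
    by (intro connection_least) (auto intro: connection_edge)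
  then show "(x, y) \<in> connection ?R \<Longrightarrow> (x, y) \<in> connection (G \<union> H)" by blast
next
  \<comment> \<open>A path may stop at a vertex of \<open>G\<close> outside \<open>W\<close>, which
    the contracted graph does not reach. For such a \<open>q\<close> the invariant records instead
    the point \<open>w\<close> of \<open>W\<close> from which the current stretch in
    \<open>G\<close> started.\<close>
  let ?inv = "\<lambda>q. ((q \<in> Field G \<longrightarrow> q \<in> W) \<longrightarrow> (x, q) \<in> connection ?R) \<and>
    (q \<in> Field G \<longrightarrow> (\<exists>w\<in>W. (x, w) \<in> connection ?R \<and> (w, q) \<in> connection G))"
  assume "(x, y) \<in> connection (G \<union> H)"
  then have "?inv y"
    unfolding connection_def[of "G \<union> H"]
  proof (induction rule: rtrancl_induct)
    case base
    show ?case using x by (auto intro!: bexI[of _ x])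
  next
    case (step q r)
    consider (G) "(q, r) \<in> G \<union> G\<inverse>" | (H) "(q, r) \<in> H \<union> H\<inverse>"
      using step.hyps(2) by blast
    then show ?case
    proof cases
      case G
      then have fld: "q \<in> Field G" "r \<in> Field G" by (auto simp: Field_def)
      then obtain w where w: "w \<in> W" "(x, w) \<in> connection ?R" "(w, q) \<in> connection G"
        using step.IH by blast
      have "(q, r) \<in> connection G"
        using G by (auto intro: connection_edge connection_sym)
      with w(3) have wr: "(w, r) \<in> connection G" by (rule connection_trans)
      have "(x, r) \<in> connection ?R" if "r \<in> W"
        using wr w that by (blast intro: connection_trans connection_edge)
      with fld w wr show ?thesis by blast
    next
      case H
      then have "q \<in> Field H" "r \<in> Field H" by (auto simp: Field_def)
      \<comment> \<open>An end of an edge of \<open>H\<close> that lies in \<open>Field G\<close>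
        must lie in \<open>W\<close>, so a contracted stretch can close or open there.\<close>
      then have qr: "q \<in> Field G \<longrightarrow> q \<in> W" "r \<in> Field G \<longrightarrow> r \<in> W" using W by auto
      have "(q, r) \<in> connection ?R"
        using H by (auto intro: connection_edge connection_sym)
      with qr step.IH have "(x, r) \<in> connection ?R" by (blast intro: connection_trans)
      with qr show ?thesis by (auto intro!: bexI[of _ r])
    qed
  qed
  with y show "(x, y) \<in> connection ?R" by blast
qed

section \<open>Counting components\<close>

lemma connection_insert_cases:
  assumes "(x, y) \<in> connection (insert (u, v) E)"
  shows "(x, y) \<in> connection E \<or> (x, u) \<in> connection E \<or> (y, u) \<in> connection E"
proof -
  \<comment> \<open>Stronger than the goal, to make the induction work: a path can be shortened to
    cross the new edge at most once, in one of its two directions.\<close>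
  have "(x, y) \<in> connection E \<or> (x, u) \<in> connection E \<and> (v, y) \<in> connection E \<or>
      (x, v) \<in> connection E \<and> (u, y) \<in> connection E"
    using assms unfolding connection_def[of "insert (u, v) E"]
  proof (induction rule: rtrancl_induct)
    case (step y z)
    then consider "(y, z) \<in> E \<union> E\<inverse>" | "y = u" "z = v" | "y = v" "z = u" by auto
    then show ?case
    proof cases
      case 1
      then have "(y, z) \<in> connection E" by (auto intro: connection_edge connection_sym)
      with step.IH show ?thesis by (blast intro: connection_trans)
    next
      case 2
      with step.IH show ?thesis by simp (blast intro: connection_sym connection_trans)
    next
      case 3
      with step.IH show ?thesis by simp (blast intro: connection_sym connection_trans)
    qed
  qed simp
  then show ?thesis by (blast intro: connection_sym)
qed

text \<open>The bound "at least |V| - |E| components", expressed by representatives of distinct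
  components. A new edge at \<open>u\<close> can only merge the component of \<open>u\<close> with
  another one, so dropping the representative joined to \<open>u\<close>, of which there is at most
  one, keeps the others separated.\<close>

lemma exists_disconnected_subset:
  assumes "finite V" "finite E"
  shows "\<exists>C\<subseteq>V. card V \<le> card C + card E \<and>
    (\<forall>x\<in>C. \<forall>y\<in>C. (x, y) \<in> connection E \<longrightarrow> x = y)"
  using assms(2)
proof (induction E rule: finite_induct)
  case empty
  show ?case by (rule exI[of _ V]) (simp add: connection_def)
next
  case (insert e E)
  obtain u v where e: "e = (u, v)" by (cases e)
  from insert.IH obtain C where C: "C \<subseteq> V" "card V \<le> card C + card E"
    and sep: "\<And>x y. x \<in> C \<Longrightarrow> y \<in> C \<Longrightarrow> (x, y) \<in> connection E \<Longrightarrow> x = y" by blast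
  let ?U = "{x \<in> C. (x, u) \<in> connection E}"
  have "x = y" if "x \<in> ?U" "y \<in> ?U" for x y
    using that by (intro sep) (blast intro: connection_sym connection_trans)+
  then have "card ?U \<le> 1"
    by (metis (no_types, lifting) card_le_Suc0_iff_eq card.infinite One_nat_def le0)
  then have "card C \<le> card (C - ?U) + 1"
    using diff_card_le_card_Diff[of ?U C] C(1) assms(1) by (auto dest: finite_subset)
  moreover have "x = y" if "x \<in> C - ?U" "y \<in> C - ?U" "(x, y) \<in> connection (insert e E)" for x y
    using that sep connection_insert_cases[of x y u v E] by (auto simp: e)
  ultimately show ?case
    using C insert.hyps by (intro exI[of _ "C - ?U"]) auto
qed

section \<open>The partition monoid\<close>

lemma finite_verts [simp]: "finite (verts n)"
  by (simp add: verts_def plain_verts_def primed_verts_def)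

lemma in_verts [simp]:
  "Plain i \<in> verts n \<longleftrightarrow> i \<in> {1..n}"
  "Primed i \<in> verts n \<longleftrightarrow> i \<in> {1..n}"
  "DPrimed i \<notin> verts n"
  by (auto simp: verts_def plain_verts_def primed_verts_def)

lemma in_vertsE:
  assumes "x \<in> verts n"
  obtains i where "i \<in> {1..n}" "x = Plain i" | i where "i \<in> {1..n}" "x = Primed i"
  using assms by (auto simp: verts_def plain_verts_def primed_verts_def)

lemma equiv_block_graph:
  assumes "a \<in> partitions n"
  shows "equiv (verts n) (block_graph a)"
proof -
  have "block_graph a = {(x, y). \<exists>A\<in>a. x \<in> A \<and> y \<in> A}" by (auto simp: block_graph_def)
  then show ?thesis
    using equiv_partition_on[of "verts n" a] assms by (simp add: partitions_def)
qed

lemma block_graph_subset: "a \<in> partitions n \<Longrightarrow> block_graph a \<subseteq> verts n \<times> verts n"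
  by (auto simp: partitions_def block_graph_def partition_on_def)

lemma components_block_graph: "a \<in> partitions n \<Longrightarrow> components (verts n) (block_graph a) = a"
  using represents_block_graph by (simp add: represents_def)

lemma block_graph_product:
  "block_graph (partition_product n a b) = connection (product_graph a b) \<inter> verts n \<times> verts n"
  by (simp add: partition_product_def block_graph_components_eq)

lemma partition_product_closed: "partition_product n a b \<in> partitions n"
  by (simp add: partitions_def partition_product_def partition_on_components)

text \<open>Products of three factors are compared in a graph with four layers of vertices.\<close>

fun layers :: "nat \<Rightarrow> nat \<Rightarrow> nat \<Rightarrow> vertex \<Rightarrow> nat \<times> nat" where
  "layers k l m (Plain x) = (k, x)"
| "layers k l m (DPrimed x) = (l, x)"
| "layers k l m (Primed x) = (m, x)"

text \<open>The repeated \<open>k\<close> is a filler for double-primed vertices, which do not occur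
  in blocks of a partition; \<open>layers_cong\<close> exchanges it for a genuine middle
  layer.\<close>

abbreviation layer_graph :: "nat \<Rightarrow> nat \<Rightarrow> vertex set set \<Rightarrow> ((nat \<times> nat) \<times> (nat \<times> nat)) set"
  where "layer_graph k m a \<equiv> map_prod (layers k k m) (layers k k m) ` block_graph a"

lemma inj_layers: "k \<noteq> l \<Longrightarrow> l \<noteq> m \<Longrightarrow> k \<noteq> m \<Longrightarrow> inj (layers k l m)"
proof (rule injI)
  fix x y assume "k \<noteq> l" "l \<noteq> m" "k \<noteq> m" "layers k l m x = layers k l m y"
  then show "x = y" by (cases x; cases y) auto
qed

lemma layers_cong: "x \<in> verts n \<Longrightarrow> layers k l m x = layers k l' m x"
  by (auto elim!: in_vertsE)

lemma image_map_prod_cong: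
  assumes "R \<subseteq> V \<times> V" "\<And>x. x \<in> V \<Longrightarrow> f x = g x"
  shows "map_prod f f ` R = map_prod g g ` R"
  using assms by (intro image_cong) auto

lemma layers_product_graph:
  assumes "a \<in> partitions n" "b \<in> partitions n"
  shows "map_prod (layers k l m) (layers k l m) ` product_graph a b = layer_graph k l a \<union> layer_graph l m b"
proof -
  have "map_prod (layers k l m \<circ> lower_to_middle) (layers k l m \<circ> lower_to_middle) ` block_graph a
      = layer_graph k l a"
    using block_graph_subset[OF assms(1)] by (rule image_map_prod_cong) (auto elim: in_vertsE)
  moreover have
    "map_prod (layers k l m \<circ> upper_to_middle) (layers k l m \<circ> upper_to_middle) ` block_graph b
      = layer_graph l m b"
    using block_graph_subset[OF assms(2)] by (rule image_map_prod_cong) (auto elim: in_vertsE)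
  ultimately show ?thesis
    by (simp add: product_graph_def glue_def image_Un image_image map_prod.comp
        flip: map_prod.compositionality)
qed

lemma layers_verts: "layers k l m ` verts n = {k, m} \<times> {1..n}"
  by (force simp: verts_def plain_verts_def primed_verts_def image_iff)

text \<open>Brings a product into the shape required by \<open>connection_contract\<close>, with
  \<open>W\<close> the two outer layers of the stack.\<close>

lemma layer_graph_product:
  assumes ab: "a \<in> partitions n" "b \<in> partitions n" and ne: "k \<noteq> l" "l \<noteq> m" "k \<noteq> m"
  shows "layer_graph k m (partition_product n a b) =
    connection (layer_graph k l a \<union> layer_graph l m b) \<inter> ({k, m} \<times> {1..n}) \<times> ({k, m} \<times> {1..n})"
proof -
  let ?f = "layers k l m"
  \<comment> \<open>Replacing the filler \<open>k\<close> by \<open>l\<close> makes the relabelling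
    injective, so that it preserves connectivity both ways.\<close>
  have "layer_graph k m (partition_product n a b) =
      map_prod ?f ?f ` (connection (product_graph a b) \<inter> verts n \<times> verts n)"
    unfolding block_graph_product by (rule image_map_prod_cong[of _ "verts n"]) (auto intro: layers_cong)
  also have "\<dots> = connection (map_prod ?f ?f ` product_graph a b) \<inter> ?f ` verts n \<times> ?f ` verts n"
    using connection_map_inj[OF inj_layers[OF ne]] by auto
  finally show ?thesis
    by (simp only: layers_product_graph[OF ab] layers_verts)
qed

lemma Field_layer_graph:
  assumes "a \<in> partitions n"
  shows "Field (layer_graph k m a) \<subseteq> {k, m} \<times> {1..n}"
proof -
  have "Field (layer_graph k m a) \<subseteq> layers k k m ` verts n"
    using block_graph_subset[OF assms] by (auto simp: Field_def)
  then show ?thesis by (simp only: layers_verts)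
qed

text \<open>Both bracketings are compared with a single stack of \<open>a\<close>, \<open>b\<close>,
  \<open>c\<close> on layers 0 to 3. Here layer 1 is interior to the product of \<open>a\<close> and
  \<open>b\<close>, and that part is contracted onto layers 0 and 2.\<close>

lemma connection_product3_left:
  assumes abc: "a \<in> partitions n" "b \<in> partitions n" "c \<in> partitions n"
    and xy: "x \<in> verts n" "y \<in> verts n"
  shows "(x, y) \<in> connection (product_graph (partition_product n a b) c) \<longleftrightarrow>
    (layers 0 0 3 x, layers 0 0 3 y) \<in> connection (layer_graph 0 1 a \<union> layer_graph 1 2 b \<union> layer_graph 2 3 c)"
proof -
  let ?f = "layers 0 2 3" and ?W = "{0, 2} \<times> {1..n}"
  have "(x, y) \<in> connection (product_graph (partition_product n a b) c) \<longleftrightarrow>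
      (?f x, ?f y) \<in> connection (map_prod ?f ?f ` product_graph (partition_product n a b) c)"
    by (rule connection_map_inj[symmetric]) (simp add: inj_layers)
  also have "map_prod ?f ?f ` product_graph (partition_product n a b) c =
      connection (layer_graph 0 1 a \<union> layer_graph 1 2 b) \<inter> ?W \<times> ?W \<union> layer_graph 2 3 c"
    by (simp add: layers_product_graph[OF partition_product_closed abc(3)]
        layer_graph_product[OF abc(1,2), of 0 1 2])
  also have "(?f x, ?f y) \<in> connection \<dots> \<longleftrightarrow>
      (?f x, ?f y) \<in> connection (layer_graph 0 1 a \<union> layer_graph 1 2 b \<union> layer_graph 2 3 c)"
  proof (rule connection_contract)
    have G: "Field (layer_graph 0 1 a \<union> layer_graph 1 2 b) \<subseteq> {0, 1, 2} \<times> {1..n}"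
      using Field_layer_graph[OF abc(1), of 0 1] Field_layer_graph[OF abc(2), of 1 2] by (auto simp: Field_Un)
    with Field_layer_graph[OF abc(3), of 2 3]
    show "Field (layer_graph 0 1 a \<union> layer_graph 1 2 b) \<inter> Field (layer_graph 2 3 c) \<subseteq> ?W" by auto
    show "?f x \<in> ?W" if "?f x \<in> Field (layer_graph 0 1 a \<union> layer_graph 1 2 b)"
      using xy(1) G that by (auto elim!: in_vertsE)
    show "?f y \<in> ?W" if "?f y \<in> Field (layer_graph 0 1 a \<union> layer_graph 1 2 b)"
      using xy(2) G that by (auto elim!: in_vertsE)
  qed
  finally show ?thesis
    using xy by (simp add: layers_cong[of _ n 0 2 3 0])
qed

text \<open>The mirror image: layer 2 is interior to the product of \<open>b\<close> and
  \<open>c\<close>, which is contracted onto layers 1 and 3.\<close>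

lemma connection_product3_right:
  assumes abc: "a \<in> partitions n" "b \<in> partitions n" "c \<in> partitions n"
    and xy: "x \<in> verts n" "y \<in> verts n"
  shows "(x, y) \<in> connection (product_graph a (partition_product n b c)) \<longleftrightarrow>
    (layers 0 0 3 x, layers 0 0 3 y) \<in> connection (layer_graph 0 1 a \<union> layer_graph 1 2 b \<union> layer_graph 2 3 c)"
proof -
  let ?f = "layers 0 1 3" and ?W = "{1, 3} \<times> {1..n}"
  have bc: "layer_graph 1 3 (partition_product n b c) = connection (layer_graph 1 2 b \<union> layer_graph 2 3 c) \<inter> ?W \<times> ?W"
    by (rule layer_graph_product[OF abc(2,3)]) simp_all
  have lift: "(x, y) \<in> connection (product_graph a (partition_product n b c)) \<longleftrightarrow>
      (?f x, ?f y) \<in> connection (map_prod ?f ?f ` product_graph a (partition_product n b c))"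
    by (rule connection_map_inj[symmetric]) (simp add: inj_layers)
  have lifted: "map_prod ?f ?f ` product_graph a (partition_product n b c) =
      connection (layer_graph 1 2 b \<union> layer_graph 2 3 c) \<inter> ?W \<times> ?W \<union> layer_graph 0 1 a"
    unfolding layers_product_graph[OF abc(1) partition_product_closed] bc by (rule Un_commute)
  have contract: "(?f x, ?f y) \<in> connection
        (connection (layer_graph 1 2 b \<union> layer_graph 2 3 c) \<inter> ?W \<times> ?W \<union> layer_graph 0 1 a) \<longleftrightarrow>
      (?f x, ?f y) \<in> connection (layer_graph 1 2 b \<union> layer_graph 2 3 c \<union> layer_graph 0 1 a)"
  proof (rule connection_contract)
    have G: "Field (layer_graph 1 2 b \<union> layer_graph 2 3 c) \<subseteq> {1, 2, 3} \<times> {1..n}"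
      using Field_layer_graph[OF abc(2), of 1 2] Field_layer_graph[OF abc(3), of 2 3] by (auto simp: Field_Un)
    with Field_layer_graph[OF abc(1), of 0 1]
    show "Field (layer_graph 1 2 b \<union> layer_graph 2 3 c) \<inter> Field (layer_graph 0 1 a) \<subseteq> ?W" by auto
    show "?f x \<in> ?W" if "?f x \<in> Field (layer_graph 1 2 b \<union> layer_graph 2 3 c)"
      using xy(1) G that by (auto elim!: in_vertsE)
    show "?f y \<in> ?W" if "?f y \<in> Field (layer_graph 1 2 b \<union> layer_graph 2 3 c)"
      using xy(2) G that by (auto elim!: in_vertsE)
  qed
  have perm: "layer_graph 1 2 b \<union> layer_graph 2 3 c \<union> layer_graph 0 1 a =
      layer_graph 0 1 a \<union> layer_graph 1 2 b \<union> layer_graph 2 3 c"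
    by (rule trans[OF Un_commute Un_assoc[symmetric]])
  show ?thesis
    using lift[unfolded lifted contract perm]
    unfolding layers_cong[OF xy(1), of 0 1 3 0] layers_cong[OF xy(2), of 0 1 3 0] .
qed

lemma partition_product_assoc:
  assumes "a \<in> partitions n" "b \<in> partitions n" "c \<in> partitions n"
  shows "partition_product n (partition_product n a b) c =
    partition_product n a (partition_product n b c)"
  unfolding partition_product_def[of n "partition_product n a b" c]
    partition_product_def[of n a "partition_product n b c"]
  by (rule components_cong)
    (simp only: connection_product3_left[OF assms] connection_product3_right[OF assms])

section \<open>The involution\<close>

lemma inj_swap_primes: "inj swap_primes"
proof (rule injI)
  fix x y assume "swap_primes x = swap_primes y"
  then show "x = y" by (cases x; cases y) auto
qed

lemma swap_primes_involution [simp]: "swap_primes (swap_primes x) = x"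
  by (cases x) auto

lemma swap_primes_plain_verts: "swap_primes ` plain_verts n = primed_verts n"
  by (simp add: plain_verts_def primed_verts_def image_image)

lemma swap_primes_primed_verts: "swap_primes ` primed_verts n = plain_verts n"
  by (simp add: plain_verts_def primed_verts_def image_image)

lemma swap_primes_verts: "swap_primes ` verts n = verts n"
  by (auto simp: verts_def image_Un swap_primes_plain_verts swap_primes_primed_verts)

lemma star_star [simp]: "star (star a) = a"
  by (simp add: star_def image_image)

lemma block_graph_star: "block_graph (star a) = map_prod swap_primes swap_primes ` block_graph a"
  by (fastforce simp: block_graph_def star_def)

lemma star_components:
  "star (components (verts n) E) = components (verts n) (map_prod swap_primes swap_primes ` E)"
  using components_image[OF inj_swap_primes, of "verts n" E]
  by (simp add: star_def swap_primes_verts)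

lemma star_closed: "a \<in> partitions n \<Longrightarrow> star a \<in> partitions n"
  using star_components[of n "block_graph a"] components_block_graph[of a n]
  by (simp add: partitions_def partition_on_components)

text \<open>Turning the product graph upside down fixes the middle row and exchanges
  \<open>lower_to_middle\<close> with \<open>upper_to_middle\<close>, hence the roles of the
  factors.\<close>

lemma star_product: "star (partition_product n a b) = partition_product n (star b) (star a)"
proof -
  have low: "lower_to_middle (swap_primes v) = swap_primes (upper_to_middle v)" for v
    by (cases v) auto
  have up: "upper_to_middle (swap_primes v) = swap_primes (lower_to_middle v)" for v
    by (cases v) auto
  have "product_graph (star b) (star a) = map_prod swap_primes swap_primes ` product_graph a b"
    by (simp add: product_graph_def glue_def block_graph_star image_Un image_image
        map_prod_def case_prod_unfold low up Un_commute)
  then show ?thesis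
    by (simp add: partition_product_def star_components)
qed

lemma rank_star: "rank n (star a) = rank n a"
proof -
  have "swap_primes ` A \<inter> plain_verts n = swap_primes ` (A \<inter> primed_verts n)"
    "swap_primes ` A \<inter> primed_verts n = swap_primes ` (A \<inter> plain_verts n)" for A
    by (simp_all add: image_Int[OF inj_swap_primes] swap_primes_plain_verts swap_primes_primed_verts)
  then have meets: "swap_primes ` A \<inter> plain_verts n \<noteq> {} \<longleftrightarrow> A \<inter> primed_verts n \<noteq> {}"
    "swap_primes ` A \<inter> primed_verts n \<noteq> {} \<longleftrightarrow> A \<inter> plain_verts n \<noteq> {}" for A
    by simp_all
  have "transversals n (star a) = (`) swap_primes ` transversals n a"
    by (simp only: transversals_def star_def Compr_image_eq meets conj_commute)
  moreover have "inj_on ((`) swap_primes) (transversals n a)"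
    using inj_swap_primes by (auto intro: inj_onI simp: inj_image_eq_iff)
  ultimately show ?thesis
    by (simp add: rank_def card_image)
qed

section \<open>Identity laws and the monoid\<close>

lemma star_identity: "star (identity_partition n) = identity_partition n"
  by (simp add: star_def identity_partition_def image_image insert_commute)

lemma identity_closed: "identity_partition n \<in> partitions n"
  unfolding partitions_def mem_Collect_eq
proof (rule partition_onI)
  show "\<Union> (identity_partition n) = verts n"
    by (fastforce simp: identity_partition_def elim!: in_vertsE)
qed (auto simp: identity_partition_def disjnt_def)

lemma partition_product_one_left:
  assumes "a \<in> partitions n"
  shows "partition_product n (identity_partition n) a = a"
proof -
  let ?G = "product_graph (identity_partition n) a"
  \<comment> \<open>Folds the middle row onto the top row: edges coming from the identity collapse
    to loops, and those coming from \<open>a\<close> return to their original places.\<close>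
  define f where "f v = (case v of DPrimed i \<Rightarrow> Plain i | _ \<Rightarrow> v)" for v
  have f_eq: "f x = x" if "x \<in> verts n" for x
    using that by (auto simp: f_def elim!: in_vertsE)
  have f_up: "f (upper_to_middle x) = x" if "x \<in> verts n" for x
    using that by (auto simp: f_def elim!: in_vertsE)
  \<comment> \<open>For the converse, a path in \<open>a\<close> is moved to the lower half of the
    product graph and its ends are joined back to the original vertices.\<close>
  have mid: "(x, upper_to_middle x) \<in> connection ?G" if "x \<in> verts n" for x
    using that
  proof (cases rule: in_vertsE)
    case (1 i)
    then have "(Plain i, Primed i) \<in> block_graph (identity_partition n)"
      by (auto simp: block_graph_def identity_partition_def)
    then have "(Plain i, DPrimed i) \<in> ?G"
      by (force simp: product_graph_def glue_def)
    with 1 show ?thesis by (auto intro: connection_edge)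
  qed auto
  have edge: "(f u, f v) \<in> connection (block_graph a)" if "(u, v) \<in> ?G" for u v
  proof -
    from that consider x y where "(x, y) \<in> block_graph (identity_partition n)"
        "u = lower_to_middle x" "v = lower_to_middle y"
      | x y where "(x, y) \<in> block_graph a" "u = upper_to_middle x" "v = upper_to_middle y"
      by (auto simp: product_graph_def glue_def)
    then show ?thesis
    proof cases
      case 1
      then have "f u = f v"
        by (auto simp: block_graph_def identity_partition_def f_def)
      then show ?thesis by simp
    next
      case 2
      then have "x \<in> verts n" "y \<in> verts n" using block_graph_subset[OF assms] by auto
      with 2 show ?thesis by (simp add: f_up connection_edge)
    qed
  qed
  have "partition_product n (identity_partition n) a = components (verts n) (block_graph a)"
    unfolding partition_product_def
  proof (rule components_cong)
    fix x y assume xy: "x \<in> verts n" "y \<in> verts n"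
    show "(x, y) \<in> connection ?G \<longleftrightarrow> (x, y) \<in> connection (block_graph a)"
    proof
      assume "(x, y) \<in> connection ?G"
      then have "(f x, f y) \<in> connection (block_graph a)"
        by (rule connection_map) (rule edge)
      then show "(x, y) \<in> connection (block_graph a)" using xy by (simp add: f_eq)
    next
      assume "(x, y) \<in> connection (block_graph a)"
      then have "(upper_to_middle x, upper_to_middle y) \<in> connection ?G"
        by (rule connection_map) (force simp: product_graph_def glue_def intro: connection_edge)
      with mid[OF xy(1)] mid[OF xy(2)] show "(x, y) \<in> connection ?G"
        by (blast intro: connection_trans connection_sym)
    qed
  qed
  with components_block_graph[OF assms] show ?thesis by simp
qed

text \<open>Follows from the left law through the involution, which fixes the identity.\<close>

lemma partition_product_one_right:
  assumes "a \<in> partitions n"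
  shows "partition_product n a (identity_partition n) = a"
proof -
  have "star (partition_product n a (identity_partition n)) = star a"
    using partition_product_one_left[OF star_closed[OF assms]] by (simp add: star_product star_identity)
  then show ?thesis by (metis star_star)
qed

lemma monoid_partition_monoid: "monoid (partition_monoid n)"
  by (rule monoidI) (simp_all add: partition_monoid_def partition_product_closed identity_closed
      partition_product_assoc partition_product_one_left partition_product_one_right)

lemma involution_star: "involution (partition_monoid n) star"
  by (simp add: involution_def partition_monoid_def star_closed star_product)

section \<open>The rank inequality\<close>

lemma finite_partition: "a \<in> partitions n \<Longrightarrow> finite a"
  by (rule finite_elements[OF finite_verts]) (simp add: partitions_def)

lemma transversals_iff:
  "A \<in> transversals n a \<longleftrightarrow>
    A \<in> a \<and> (\<exists>i\<in>{1..n}. Plain i \<in> A) \<and> (\<exists>i\<in>{1..n}. Primed i \<in> A)"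
  unfolding transversals_def plain_verts_def primed_verts_def by blast

lemma card_partition_rank:
  assumes "a \<in> partitions n"
  shows "card a = card (a - transversals n a) + rank n a"
proof -
  have sub: "transversals n a \<subseteq> a" by (auto simp: transversals_def)
  have fin: "finite a" by (rule finite_partition[OF assms])
  show ?thesis
    using card_Diff_subset[OF finite_subset[OF sub fin] sub] card_mono[OF fin sub]
    by (simp add: rank_def)
qed

text \<open>Lets the block containing \<open>x\<close> be named by an explicit term, without
  choosing it.\<close>

lemma partition_block_eq:
  assumes "a \<in> partitions n" "A \<in> a" "x \<in> A"
  shows "block_graph a `` {x} = A"
proof -
  have "disjoint a" using assms(1) by (simp add: partitions_def partition_on_def)
  then have "B \<in> a \<and> x \<in> B \<longleftrightarrow> B = A" for B
    using assms(2,3) by (meson disjointD disjoint_iff)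
  moreover have "block_graph a `` {x} = {y. \<exists>B. (B \<in> a \<and> x \<in> B) \<and> y \<in> B}"
    by (auto simp: block_graph_def)
  ultimately show ?thesis by simp
qed

lemma partition_block_in:
  assumes "a \<in> partitions n" "x \<in> verts n"
  shows "block_graph a `` {x} \<in> a" "x \<in> block_graph a `` {x}"
proof -
  have "x \<in> \<Union> a"
    using assms partition_onD1[of "verts n" a] by (simp add: partitions_def)
  then obtain A where "A \<in> a" "x \<in> A" by blast
  with partition_block_eq[OF assms(1) this]
  show "block_graph a `` {x} \<in> a" "x \<in> block_graph a `` {x}"
    by simp_all
qed

lemma rank_inequality:
  assumes a: "a \<in> partitions n" and b: "b \<in> partitions n"
  shows "rank n a + rank n b \<le> rank n (partition_product n a b) + n"
proof -
  let ?ab = "partition_product n a b" and ?G = "product_graph a b"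
  let ?a = "\<lambda>x. block_graph a `` {x}" and ?b = "\<lambda>x. block_graph b `` {x}"
  \<comment> \<open>The sum type keeps blocks of \<open>a\<close> and \<open>b\<close> apart even if
    they are equal as sets. Different \<open>i\<close> may give the same edge, so there are at most
    \<open>n\<close> edges.\<close>
  define E :: "((vertex set + vertex set) \<times> (vertex set + vertex set)) set"
    where "E = (\<lambda>i. (Inl (?a (Primed i)), Inr (?b (Plain i)))) ` {1..n}"
  \<comment> \<open>A middle vertex lies in a block of \<open>a\<close> and in a block of \<open>b\<close>; these are adjacent, and
    the former is taken.\<close>
  define node where "node v = (case v of Plain i \<Rightarrow> Inl (?a (Plain i))
    | DPrimed i \<Rightarrow> Inl (?a (Primed i)) | Primed i \<Rightarrow> Inr (?b (Primed i)))" for v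
  have edge: "(Inl A, Inr B) \<in> connection E"
    if "A \<in> a" "B \<in> b" "Primed j \<in> A" "Plain j \<in> B" for A B j
  proof -
    have "j \<in> {1..n}"
      using partition_onD1[of "verts n" a] a that in_verts(2)[of j n]
      by (metis UnionI mem_Collect_eq partitions_def)
    then show ?thesis
      using that partition_block_eq[OF a] partition_block_eq[OF b]
      by (auto simp: E_def intro!: connection_edge image_eqI[of _ _ j])
  qed
  have node_lower: "node (lower_to_middle x) = Inl (?a x)" if "x \<in> verts n" for x
    using that by (auto simp: node_def elim!: in_vertsE)
  \<comment> \<open>Only connectedness, not equality: for \<open>x = Plain i\<close> the vertex is a
    middle one, and \<open>node\<close> takes its block in \<open>a\<close>, the neighbour of its
    block in \<open>b\<close>.\<close>
  have node_upper: "(node (upper_to_middle x), Inr (?b x)) \<in> connection E" if "x \<in> verts n" for x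
    using that
  proof (cases rule: in_vertsE)
    case (1 i)
    then show ?thesis by (auto simp: node_def E_def intro!: connection_edge)
  qed (simp add: node_def)
  \<comment> \<open>Hence all vertices of one block of the product have their nodes in a single
    component of the graph on blocks.\<close>
  have node_connection: "(node x, node y) \<in> connection E" if "(x, y) \<in> connection ?G" for x y
    using that
  proof (rule connection_map)
    fix u v assume "(u, v) \<in> ?G"
    then consider x y where "(x, y) \<in> block_graph a" "u = lower_to_middle x" "v = lower_to_middle y"
      | x y where "(x, y) \<in> block_graph b" "u = upper_to_middle x" "v = upper_to_middle y"
      by (auto simp: product_graph_def glue_def)
    then show "(node u, node v) \<in> connection E"
    proof cases
      case 1
      then have "x \<in> verts n" "y \<in> verts n" "?a x = ?a y"
        using block_graph_subset[OF a] equiv_class_eq[OF equiv_block_graph[OF a]] by auto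
      with 1 show ?thesis by (simp add: node_lower)
    next
      case 2
      then have "x \<in> verts n" "y \<in> verts n" "?b x = ?b y"
        using block_graph_subset[OF b] equiv_class_eq[OF equiv_block_graph[OF b]] by auto
      with 2 node_upper[of x] node_upper[of y] show ?thesis
        by simp (blast intro: connection_trans connection_sym)
    qed
  qed
  obtain C where C: "C \<subseteq> a <+> b" "card (a <+> b) \<le> card C + card E"
    and sep: "\<And>c d. c \<in> C \<Longrightarrow> d \<in> C \<Longrightarrow> (c, d) \<in> connection E \<Longrightarrow> c = d"
    using exists_disconnected_subset[of "a <+> b" E] finite_partition a b
    by (auto simp: E_def)
  \<comment> \<open>The targets found in the component of \<open>c\<close>: its non-transversal
    blocks, and the transversals of the product having a vertex whose node lies there.\<close>
  define R where "R c t = (case t of Inl N \<Rightarrow> (c, N) \<in> connection E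
    | Inr T \<Rightarrow> \<exists>x\<in>T. (c, node x) \<in> connection E)" for c t
  let ?N = "(a - transversals n a) <+> (b - transversals n b)"
  \<comment> \<open>Every \<open>c\<close> has a target and no target serves two elements of
    \<open>C\<close>. A component may have several targets, so a relation replaces an
    injection.\<close>
  have "card C \<le> card (?N <+> transversals n ?ab)"
  proof (rule card_le_if_inj_on_rel[where r = R])
    show "finite (?N <+> transversals n ?ab)"
      using finite_partition a b finite_partition[OF partition_product_closed, of n a b]
      by (simp add: transversals_def)
    show "c = d" if "c \<in> C" "d \<in> C" "t \<in> ?N <+> transversals n ?ab" "R c t" "R d t" for c d t
    proof (cases t)
      case (Inl N)
      with that have "(c, d) \<in> connection E"
        by (simp add: R_def) (blast intro: connection_trans connection_sym)
      with sep that show ?thesis by blast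
    next
      case (Inr T)
      with that obtain x y where xy: "x \<in> T" "y \<in> T" "(c, node x) \<in> connection E"
        "(d, node y) \<in> connection E" by (auto simp: R_def)
      have "T \<in> ?ab" using that(3) Inr by (auto simp: transversals_def)
      with xy have "(x, y) \<in> block_graph ?ab" by (auto simp: block_graph_def)
      then have "(node x, node y) \<in> connection E"
        by (intro node_connection) (simp add: block_graph_product)
      with xy have "(c, d) \<in> connection E" by (blast intro: connection_trans connection_sym)
      with sep that show ?thesis by blast
    qed
    \<comment> \<open>One edge of the component suffices: either an end is not a transversal and is
      a target, or both are, and the path from \<open>Plain i\<close> through
      \<open>DPrimed j\<close> to \<open>Primed k\<close> gives a transversal of the
      product.\<close>
    have linked: "\<exists>t\<in>?N <+> transversals n ?ab. R c t"
      if AB: "A \<in> a" "B \<in> b" "Primed j \<in> A" "Plain j \<in> B" and c: "(c, Inl A) \<in> connection E"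
      for c A B j
    proof (cases "A \<in> transversals n a \<and> B \<in> transversals n b")
      case False
      have "(c, Inr B) \<in> connection E"
        using c edge[OF AB] by (rule connection_trans)
      with False c AB show ?thesis
        by (auto simp: R_def intro: bexI[of _ "Inl (Inl A)"] bexI[of _ "Inl (Inr B)"])
    next
      case True
      then obtain i k where ik: "i \<in> {1..n}" "Plain i \<in> A" "k \<in> {1..n}" "Primed k \<in> B"
        unfolding transversals_iff by blast
      have "(Plain i, Primed j) \<in> block_graph a" "(Plain j, Primed k) \<in> block_graph b"
        using AB ik by (auto simp: block_graph_def)
      then have "(Plain i, DPrimed j) \<in> ?G" "(DPrimed j, Primed k) \<in> ?G"
        by (force simp: product_graph_def glue_def)+
      then have "(Plain i, Primed k) \<in> connection ?G"
        by (blast intro: connection_edge connection_trans)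
      with ik have "(Plain i, Primed k) \<in> block_graph ?ab" by (simp add: block_graph_product)
      then obtain T where T: "T \<in> ?ab" "Plain i \<in> T" "Primed k \<in> T"
        by (auto simp: block_graph_def)
      have "T \<in> transversals n ?ab"
        using T ik unfolding transversals_iff by blast
      moreover have "node (Plain i) = Inl A"
        using partition_block_eq[OF a AB(1) ik(2)] by (simp add: node_def)
      ultimately show ?thesis
        using c T by (auto simp: R_def intro!: bexI[of _ "Inr T"] bexI[of _ "Plain i"])
    qed
    \<comment> \<open>A non-transversal in \<open>C\<close> is its own target; a transversal meets
      the middle row, hence has a neighbour, and \<open>linked\<close> applies.\<close>
    have "\<exists>t\<in>?N <+> transversals n ?ab. R c t" if "c \<in> C" for c
    proof -
      from that C(1) consider A where "A \<in> a" "c = Inl A" | B where "B \<in> b" "c = Inr B" by auto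
      then show ?thesis
      proof cases
        case 1
        show ?thesis
        proof (cases "A \<in> transversals n a")
          case True
          then obtain j where j: "j \<in> {1..n}" "Primed j \<in> A"
            unfolding transversals_iff by blast
          then show ?thesis
            using linked[of A "?b (Plain j)" j c] 1 partition_block_in[OF b, of "Plain j"] by auto
        next
          case False
          with 1 show ?thesis by (auto simp: R_def intro: bexI[of _ "Inl (Inl A)"])
        qed
      next
        case 2
        show ?thesis
        proof (cases "B \<in> transversals n b")
          case True
          then obtain j where j: "j \<in> {1..n}" "Plain j \<in> B"
            unfolding transversals_iff by blast
          then have A: "?a (Primed j) \<in> a" "Primed j \<in> ?a (Primed j)"
            using partition_block_in[OF a, of "Primed j"] by simp_all
          then have "(c, Inl (?a (Primed j))) \<in> connection E"
            using edge[OF A(1) _ A(2)] 2 j by (auto intro: connection_sym)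
          with linked[OF A(1) _ A(2)] 2 j show ?thesis by blast
        next
          case False
          with 2 show ?thesis by (auto simp: R_def intro: bexI[of _ "Inl (Inr B)"])
        qed
      qed
    qed
    then show "\<exists>t. t \<in> ?N <+> transversals n ?ab \<and> R c t" if "c \<in> C" for c
      using that by blast
  qed
  moreover have "card E \<le> n"
    using card_image_le[of "{1..n}"] by (simp add: E_def)
  \<comment> \<open>With r for \<open>rank n\<close>: |a| + |b| - n \<le> |C| \<le> (|a| - r(a)) +
    (|b| - r(b)) + r(ab).\<close>
  ultimately show ?thesis
    using C(2) card_partition_rank[OF a] card_partition_rank[OF b] finite_partition a b
      finite_partition[OF partition_product_closed, of n a b]
    by (simp add: card_Plus rank_def[of n ?ab] transversals_def[of n ?ab])
qed

theorem theorem4p17: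
  fixes n :: nat
  assumes "n \<ge> 1"
  shows "(\<forall>a\<in>carrier (partition_monoid n). \<forall>b\<in>carrier (partition_monoid n).
            rank n a + rank n b \<le> rank n (a \<otimes>\<^bsub>partition_monoid n\<^esub> b) + n) \<and>
         (\<exists>\<Phi> :: vertex set set \<Rightarrow> vertex set set \<Rightarrow> nat.
            (\<forall>a\<in>carrier (partition_monoid n). \<forall>b\<in>carrier (partition_monoid n).
               int (\<Phi> a b) = int n - int (rank n a) - int (rank n b)
                  + int (rank n (a \<otimes>\<^bsub>partition_monoid n\<^esub> b))) \<and>
            symmetric_twisting (partition_monoid n) star \<Phi>)"
proof (intro conjI ballI exI[of _ "\<lambda>a b. n + rank n (partition_product n a b) - rank n a - rank n b"])
  let ?M = "partition_monoid n"
  let ?\<Phi> = "\<lambda>a b. n + rank n (partition_product n a b) - rank n a - rank n b"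
  have ineq: "rank n a + rank n b \<le> rank n (partition_product n a b) + n"
    if "a \<in> carrier ?M" "b \<in> carrier ?M" for a b
    using that rank_inequality by (simp add: partition_monoid_def)
  show "rank n a + rank n b \<le> rank n (a \<otimes>\<^bsub>?M\<^esub> b) + n"
    if "a \<in> carrier ?M" "b \<in> carrier ?M" for a b
    using ineq[OF that] by (simp add: partition_monoid_def)
  \<comment> \<open>Subtraction of naturals is truncated; the rank inequality makes it agree with
    the integer formula.\<close>
  show \<Phi>: "int (?\<Phi> a b) = int n - int (rank n a) - int (rank n b) + int (rank n (a \<otimes>\<^bsub>?M\<^esub> b))"
    if "a \<in> carrier ?M" "b \<in> carrier ?M" for a b
    using ineq[OF that] by (simp add: partition_monoid_def)
  interpret monoid ?M by (rule monoid_partition_monoid)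
  show "symmetric_twisting ?M star ?\<Phi>"
    unfolding symmetric_twisting_def twisting_def
  proof (intro conjI ballI monoid_partition_monoid involution_star)
    fix a b c assume abc: "a \<in> carrier ?M" "b \<in> carrier ?M" "c \<in> carrier ?M"
    \<comment> \<open>Over the integers the rank of the inner product cancels on each side, leaving
      2n - r(a) - r(b) - r(c) + r(abc), with r for \<open>rank n\<close>.\<close>
    have "int (?\<Phi> a b + ?\<Phi> (a \<otimes>\<^bsub>?M\<^esub> b) c) = int (?\<Phi> a (b \<otimes>\<^bsub>?M\<^esub> c) + ?\<Phi> b c)"
      unfolding of_nat_add using abc by (subst (1 2 3 4) \<Phi>) (simp_all add: m_assoc)
    then show "?\<Phi> a b + ?\<Phi> (a \<otimes>\<^bsub>?M\<^esub> b) c = ?\<Phi> a (b \<otimes>\<^bsub>?M\<^esub> c) + ?\<Phi> b c"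
      by (simp only: of_nat_eq_iff)
  next
    fix a b
    show "?\<Phi> a b = ?\<Phi> (star b) (star a)"
      by (simp add: rank_star flip: star_product)
  qed
qed

end
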